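(* Let $\epsilon>0$, $N\ge1$, $\sigma\in\mathcal S_N$, $d_1,\dots,d_N\in\mathbb C$, and $A=\mathrm{diag}(d_1,\dots,d_N)+M_\sigma$. If $|d_i|<1-\epsilon$ for all $1\le i\le N$, or if $|d_i|>1+\epsilon$ for all $1\le i\le N$, then $s_{\min}(A)\ge\frac{1}{2\sqrt2}\,\epsilon$ (a lower bound independent of $N$).
   Context: $\mathcal S_N$ is the symmetric group on $\{1,\dots,N\}$. $M_\sigma$ is the $N\times N$ permutation matrix with $M_\sigma(i,j)=1$ if $\sigma(i)=j$ and $0$ otherwise. $s_{\min}$ denotes the smallest singular value. *)

theory Defs
  imports
    "Jordan_Normal_Form.Schur_Decomposition"
    "HOL-Combinatorics.Permutations"
begin

(* Matrix indices in the library start at 0, while permutations act on {1..N};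
   hence the shift by Suc. *)
definition perm_mat :: "nat \<Rightarrow> (nat \<Rightarrow> nat) \<Rightarrow> complex mat" where
  "perm_mat N \<sigma> = mat N N (\<lambda>(i, j). if \<sigma> (Suc i) = Suc j then 1 else 0)"

(* The set of square roots of the eigenvalues of A* A, without multiplicities.
   All these eigenvalues are real and nonnegative, so restricting to s \<ge> 0 loses none. *)
definition singular_values :: "complex mat \<Rightarrow> real set" where
  "singular_values A =
     {s. s \<ge> 0 \<and> eigenvalue (mat_adjoint A * A) (complex_of_real (s\<^sup>2))}"

(* Meaningful for square matrices of size at least 1, where singular_values A
   is finite and nonempty. *)
definition s_min :: "complex mat \<Rightarrow> real" where
  "s_min A = Min (singular_values A)"

end

theory Submission
  imports Defs "Jordan_Normal_Form.Spectral_Radius" "HOL-Analysis.L2_Norm"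
begin

text \<open>
  For a vector \<open>v\<close>, the matrix \<open>M\<^sub>\<sigma>\<close> only permutes the entries of \<open>v\<close>, so it preserves
  the Euclidean norm, whereas \<open>diag(d)\<close> scales every entry by a factor which, in modulus, is either
  everywhere below \<open>1 - \<epsilon>\<close> or everywhere above \<open>1 + \<epsilon>\<close>. Hence \<open>\<parallel>diag(d) v\<parallel>\<close> and
  \<open>\<parallel>M\<^sub>\<sigma> v\<parallel> = \<parallel>v\<parallel>\<close> differ by at least \<open>\<epsilon> \<parallel>v\<parallel>\<close>, and the reverse triangle inequality gives
  \<open>\<parallel>A v\<parallel> \<ge> \<epsilon> \<parallel>v\<parallel>\<close> (lemma \<open>diag_plus_perm_expanding\<close>).

  Such a lower bound passes to the singular values: if \<open>A\<^sup>* A v = s\<^sup>2 v\<close> then pairing with \<open>v\<close>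
  yields \<open>\<parallel>A v\<parallel>\<^sup>2 = s\<^sup>2 \<parallel>v\<parallel>\<^sup>2\<close>, so \<open>s \<ge> \<epsilon>\<close> (lemma \<open>s_min_ge\<close>). This is
  stronger than the claim by the factor \<open>2 \<surd>2\<close>.
\<close>

section \<open>Singular values and the Euclidean norm\<close>

definition vec_norm2 :: "complex vec \<Rightarrow> real" where
  "vec_norm2 v = L2_set (\<lambda>i. cmod (v $ i)) {..<dim_vec v}"

lemma vec_norm2_nonneg: "vec_norm2 v \<ge> 0"
  by (simp add: vec_norm2_def)

lemma of_real_vec_norm2_power2:
  assumes "v \<in> carrier_vec n"
  shows "complex_of_real ((vec_norm2 v)\<^sup>2) = (\<Sum>i<n. v $ i * cnj (v $ i))"
proof -
  have "(vec_norm2 v)\<^sup>2 = (\<Sum>i<n. (cmod (v $ i))\<^sup>2)"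
    using assms by (simp add: vec_norm2_def L2_set_def sum_nonneg)
  then show ?thesis
    by (simp only: of_real_sum complex_norm_square)
qed

lemma vec_norm2_pos:
  assumes "v \<in> carrier_vec n" and "v \<noteq> 0\<^sub>v n"
  shows "vec_norm2 v > 0"
proof -
  have "vec_norm2 v \<noteq> 0"
  proof
    assume "vec_norm2 v = 0"
    then have "\<forall>i<dim_vec v. v $ i = 0"
      by (auto simp: vec_norm2_def L2_set_eq_0_iff)
    then have "v = 0\<^sub>v n"
      using assms(1) by (intro eq_vecI) auto
    with assms(2) show False ..
  qed
  then show ?thesis
    using vec_norm2_nonneg[of v] by linarith
qed

lemma mat_adjoint_dims:
  assumes "A \<in> carrier_mat m n"
  shows "mat_adjoint A \<in> carrier_mat n m"
  using assms by (auto simp: mat_adjoint_def mat_of_rows_def)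

lemma index_mat_adjoint:
  assumes "A \<in> carrier_mat m n" and "i < n" and "j < m"
  shows "mat_adjoint A $$ (i, j) = conjugate (A $$ (j, i))"
  using assms by (auto simp: mat_adjoint_def mat_of_rows_def)

lemma index_mult_mat_vec_sum:
  assumes "A \<in> carrier_mat m n" and "v \<in> carrier_vec n" and "i < m"
  shows "(A *\<^sub>v v) $ i = (\<Sum>j<n. A $$ (i, j) * v $ j)"
  using assms by (auto simp: scalar_prod_def lessThan_atLeast0)

text \<open>Pairing the eigenvector equation with \<open>v\<close>, because \<open>\<langle>A\<^sup>* A v, v\<rangle> = \<langle>A v, A v\<rangle>\<close>.\<close>

lemma eigenvector_adjoint_mult_norm:
  fixes A :: "complex mat"
  assumes A: "A \<in> carrier_mat m n" and ev: "eigenvector (mat_adjoint A * A) v k"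
  shows "complex_of_real ((vec_norm2 (A *\<^sub>v v))\<^sup>2) = k * complex_of_real ((vec_norm2 v)\<^sup>2)"
proof -
  let ?w = "A *\<^sub>v v"
  note A' = mat_adjoint_dims[OF A]
  have v: "v \<in> carrier_vec n" and kv: "mat_adjoint A * A *\<^sub>v v = k \<cdot>\<^sub>v v"
    using ev A' by (auto simp: eigenvector_def)
  have w: "?w \<in> carrier_vec m"
    using A v by simp
  have adj: "(\<Sum>j<m. cnj (A $$ (j, i)) * ?w $ j) = k * v $ i" if "i < n" for i
  proof -
    have "(mat_adjoint A *\<^sub>v ?w) $ i = k * v $ i"
      using kv v that by (simp add: assoc_mult_mat_vec[OF A' A v, symmetric])
    then show ?thesis
      using that by (simp add: index_mult_mat_vec_sum[OF A' w] index_mat_adjoint[OF A])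
  qed
  have "complex_of_real ((vec_norm2 ?w)\<^sup>2) = (\<Sum>j<m. ?w $ j * cnj (?w $ j))"
    by (rule of_real_vec_norm2_power2[OF w])
  also have "\<dots> = (\<Sum>j<m. \<Sum>i<n. ?w $ j * (cnj (A $$ (j, i)) * cnj (v $ i)))"
    by (intro sum.cong refl)
       (simp add: index_mult_mat_vec_sum[OF A v] sum_distrib_left del: index_mult_mat_vec)
  also have "\<dots> = (\<Sum>i<n. \<Sum>j<m. ?w $ j * (cnj (A $$ (j, i)) * cnj (v $ i)))"
    by (rule sum.swap)
  also have "\<dots> = (\<Sum>i<n. (\<Sum>j<m. cnj (A $$ (j, i)) * ?w $ j) * cnj (v $ i))"
    by (simp add: sum_distrib_left mult_ac del: index_mult_mat_vec)
  also have "\<dots> = (\<Sum>i<n. k * (v $ i * cnj (v $ i)))"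
    by (simp add: adj mult.assoc del: index_mult_mat_vec)
  also have "\<dots> = k * complex_of_real ((vec_norm2 v)\<^sup>2)"
    by (simp only: of_real_vec_norm2_power2[OF v] sum_distrib_left)
  finally show ?thesis .
qed

lemma singular_value_norm:
  assumes "A \<in> carrier_mat m n" and "s \<in> singular_values A"
  obtains v where "v \<in> carrier_vec n" "v \<noteq> 0\<^sub>v n" "vec_norm2 (A *\<^sub>v v) = s * vec_norm2 v"
proof -
  from assms(2) obtain v where s: "s \<ge> 0"
    and ev: "eigenvector (mat_adjoint A * A) v (complex_of_real (s\<^sup>2))"
    by (auto simp: singular_values_def eigenvalue_def)
  have "complex_of_real ((vec_norm2 (A *\<^sub>v v))\<^sup>2) = complex_of_real ((s * vec_norm2 v)\<^sup>2)"
    using eigenvector_adjoint_mult_norm[OF assms(1) ev] by (simp add: power_mult_distrib)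
  then have "(vec_norm2 (A *\<^sub>v v))\<^sup>2 = (s * vec_norm2 v)\<^sup>2"
    using of_real_eq_iff by blast
  then have "vec_norm2 (A *\<^sub>v v) = s * vec_norm2 v"
    using s by (simp add: vec_norm2_nonneg)
  with ev mat_adjoint_dims[OF assms(1)] that[of v] show ?thesis
    by (auto simp: eigenvector_def)
qed

lemma finite_singular_values:
  assumes "A \<in> carrier_mat m n"
  shows "finite (singular_values A)"
proof (rule finite_imageD)
  have B: "mat_adjoint A * A \<in> carrier_mat n n"
    using mat_adjoint_dims[OF assms] assms by simp
  show "finite ((\<lambda>s. complex_of_real (s\<^sup>2)) ` singular_values A)"
    by (rule finite_subset[OF _ card_finite_spectrum(1)[OF B]])
       (auto simp: singular_values_def spectrum_def)
  show "inj_on (\<lambda>s. complex_of_real (s\<^sup>2)) (singular_values A)"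
    by (auto simp: inj_on_def singular_values_def simp del: of_real_power)
qed

text \<open>
  Some eigenvalue \<open>k\<close> of \<open>A\<^sup>* A\<close> exists over the complex numbers; it is the square of a real number
  because it is a quotient of two squared norms.
\<close>

lemma singular_values_nonempty:
  assumes A: "A \<in> carrier_mat m n" and "n > 0"
  shows "singular_values A \<noteq> {}"
proof -
  have A': "mat_adjoint A \<in> carrier_mat n m"
    by (rule mat_adjoint_dims[OF A])
  have B: "mat_adjoint A * A \<in> carrier_mat n n"
    using A' A by simp
  obtain k v where ev: "eigenvector (mat_adjoint A * A) v k"
    using spectrum_non_empty[OF B \<open>n > 0\<close>] by (auto simp: spectrum_def eigenvalue_def)
  have pos: "vec_norm2 v > 0"
    using ev A' by (intro vec_norm2_pos[of v n]) (auto simp: eigenvector_def)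
  let ?s = "vec_norm2 (A *\<^sub>v v) / vec_norm2 v"
  have "k = complex_of_real (?s\<^sup>2)"
    using eigenvector_adjoint_mult_norm[OF A ev] pos by (simp add: field_simps)
  then have "?s \<in> singular_values A"
    using ev unfolding singular_values_def eigenvalue_def by (auto simp: vec_norm2_nonneg)
  then show ?thesis by blast
qed

lemma s_min_ge:
  assumes A: "A \<in> carrier_mat m n" and "n > 0"
    and bound: "\<And>v. v \<in> carrier_vec n \<Longrightarrow> c * vec_norm2 v \<le> vec_norm2 (A *\<^sub>v v)"
  shows "c \<le> s_min A"
proof -
  have "s_min A \<in> singular_values A"
    unfolding s_min_def
    by (rule Min_in[OF finite_singular_values[OF A] singular_values_nonempty[OF A \<open>n > 0\<close>]])
  then obtain v where v: "v \<in> carrier_vec n" "v \<noteq> 0\<^sub>v n"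
    and "vec_norm2 (A *\<^sub>v v) = s_min A * vec_norm2 v"
    by (rule singular_value_norm[OF A])
  then have "c * vec_norm2 v \<le> s_min A * vec_norm2 v"
    using bound[OF v(1)] by simp
  then show ?thesis
    using vec_norm2_pos[OF v] by simp
qed

section \<open>A diagonal matrix plus a permutation matrix\<close>

lemma perm_mat_mult_vec_index:
  assumes \<sigma>: "\<sigma> permutes {1..N}" and v: "v \<in> carrier_vec N" and i: "i < N"
  shows "(perm_mat N \<sigma> *\<^sub>v v) $ i = v $ (\<sigma> (Suc i) - 1)"
proof -
  have "\<sigma> (Suc i) \<in> {1..N}"
    using permutes_in_image[OF \<sigma>, of "Suc i"] i by simp
  then have *: "\<sigma> (Suc i) - 1 < N" "\<And>j. \<sigma> (Suc i) = Suc j \<longleftrightarrow> j = \<sigma> (Suc i) - 1"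
    by auto
  have "(perm_mat N \<sigma> *\<^sub>v v) $ i = (\<Sum>j<N. perm_mat N \<sigma> $$ (i, j) * v $ j)"
    by (rule index_mult_mat_vec_sum[OF _ v i]) (simp add: perm_mat_def)
  also have "\<dots> = (\<Sum>j<N. if j = \<sigma> (Suc i) - 1 then v $ j else 0)"
    using i by (intro sum.cong refl) (simp add: perm_mat_def *(2))
  also have "\<dots> = v $ (\<sigma> (Suc i) - 1)"
    using *(1) by simp
  finally show ?thesis .
qed

lemma vec_norm2_perm_mat:
  assumes \<sigma>: "\<sigma> permutes {1..N}" and v: "v \<in> carrier_vec N"
  shows "vec_norm2 (perm_mat N \<sigma> *\<^sub>v v) = vec_norm2 v"
proof -
  have "bij_betw (\<lambda>k. k - 1) {1..N} {..<N}"
    by (rule bij_betw_byWitness[where f' = Suc]) auto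
  moreover have "bij_betw Suc {..<N} {1..N}"
    by (rule bij_betw_byWitness[where f' = "\<lambda>k. k - 1"]) auto
  ultimately have "bij_betw ((\<lambda>k. k - 1) \<circ> (\<sigma> \<circ> Suc)) {..<N} {..<N}"
    using permutes_imp_bij[OF \<sigma>] by (blast intro: bij_betw_trans)
  then have bij: "bij_betw (\<lambda>i. \<sigma> (Suc i) - 1) {..<N} {..<N}"
    by (simp add: comp_def)
  have "(\<Sum>i<N. (cmod ((perm_mat N \<sigma> *\<^sub>v v) $ i))\<^sup>2) = (\<Sum>i<N. (cmod (v $ (\<sigma> (Suc i) - 1)))\<^sup>2)"
    by (intro sum.cong refl) (simp add: perm_mat_mult_vec_index[OF \<sigma> v] del: index_mult_mat_vec)
  also have "\<dots> = (\<Sum>i<N. (cmod (v $ i))\<^sup>2)"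
    by (rule sum.reindex_bij_betw[OF bij])
  finally show ?thesis
    using v by (simp add: vec_norm2_def L2_set_def perm_mat_def)
qed

lemma mat_diag_mult_vec_index:
  assumes "v \<in> carrier_vec N" and "i < N"
  shows "(mat_diag N f *\<^sub>v v) $ i = f i * v $ i"
proof -
  have "(mat_diag N f *\<^sub>v v) $ i = (\<Sum>j<N. if j = i then f j * v $ j else 0)"
    unfolding index_mult_mat_vec_sum[OF mat_diag_dim assms]
    using assms(2) by (intro sum.cong refl) (auto simp: mat_diag_def)
  then show ?thesis
    using assms(2) by simp
qed

lemma vec_norm2_mat_diag_le:
  assumes v: "v \<in> carrier_vec N" and "0 \<le> c" and f: "\<And>i. i < N \<Longrightarrow> cmod (f i) \<le> c"
  shows "vec_norm2 (mat_diag N f *\<^sub>v v) \<le> c * vec_norm2 v"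
proof -
  have "L2_set (\<lambda>i. cmod ((mat_diag N f *\<^sub>v v) $ i)) {..<N} \<le> L2_set (\<lambda>i. c * cmod (v $ i)) {..<N}"
    using f by (intro L2_set_mono)
      (auto simp: mat_diag_mult_vec_index[OF v] norm_mult mult_right_mono simp del: index_mult_mat_vec)
  then show ?thesis
    using v \<open>0 \<le> c\<close> by (simp add: vec_norm2_def L2_set_right_distrib mat_diag_def)
qed

lemma vec_norm2_mat_diag_ge:
  assumes v: "v \<in> carrier_vec N" and "0 \<le> c" and f: "\<And>i. i < N \<Longrightarrow> c \<le> cmod (f i)"
  shows "c * vec_norm2 v \<le> vec_norm2 (mat_diag N f *\<^sub>v v)"
proof -
  have "L2_set (\<lambda>i. c * cmod (v $ i)) {..<N} \<le> L2_set (\<lambda>i. cmod ((mat_diag N f *\<^sub>v v) $ i)) {..<N}"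
    using f \<open>0 \<le> c\<close> by (intro L2_set_mono)
      (auto simp: mat_diag_mult_vec_index[OF v] norm_mult mult_right_mono simp del: index_mult_mat_vec)
  then show ?thesis
    using v \<open>0 \<le> c\<close> by (simp add: vec_norm2_def L2_set_right_distrib mat_diag_def)
qed

lemma vec_norm2_diff_le_add:
  assumes x: "x \<in> carrier_vec n" and y: "y \<in> carrier_vec n"
  shows "\<bar>vec_norm2 x - vec_norm2 y\<bar> \<le> vec_norm2 (x + y)"
proof -
  have tri: "L2_set (\<lambda>i. cmod (a i)) {..<n}
      \<le> L2_set (\<lambda>i. cmod (a i + b i)) {..<n} + L2_set (\<lambda>i. cmod (b i)) {..<n}"
    for a b :: "nat \<Rightarrow> complex"
  proof -
    have "cmod (a i) \<le> cmod (a i + b i) + cmod (b i)" for i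
      using norm_triangle_ineq4[of "a i + b i" "b i"] by simp
    then have "L2_set (\<lambda>i. cmod (a i)) {..<n}
        \<le> L2_set (\<lambda>i. cmod (a i + b i) + cmod (b i)) {..<n}"
      by (intro L2_set_mono) auto
    then show ?thesis
      by (rule order_trans[OF _ L2_set_triangle_ineq])
  qed
  have "vec_norm2 (x + y) = L2_set (\<lambda>i. cmod (x $ i + y $ i)) {..<n}"
    using x y by (auto simp: vec_norm2_def intro!: L2_set_cong)
  then show ?thesis
    using tri[of "\<lambda>i. x $ i" "\<lambda>i. y $ i"] tri[of "\<lambda>i. y $ i" "\<lambda>i. x $ i"] x y
    by (simp add: vec_norm2_def add.commute abs_le_iff)
qed

text \<open>
  The norm of \<open>diag(f) v\<close> stays away from \<open>\<parallel>v\<parallel>\<close>, which is the norm of \<open>M\<^sub>\<sigma> v\<close>, so the two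
  summands cannot cancel.
\<close>

lemma diag_plus_perm_expanding:
  assumes \<sigma>: "\<sigma> permutes {1..N}" and v: "v \<in> carrier_vec N" and "N \<ge> 1" and "\<epsilon> \<ge> 0"
    and f: "(\<forall>i<N. cmod (f i) \<le> 1 - \<epsilon>) \<or> (\<forall>i<N. 1 + \<epsilon> \<le> cmod (f i))"
  shows "\<epsilon> * vec_norm2 v \<le> vec_norm2 ((mat_diag N f + perm_mat N \<sigma>) *\<^sub>v v)"
proof -
  let ?x = "mat_diag N f *\<^sub>v v" and ?y = "perm_mat N \<sigma> *\<^sub>v v"
  have P: "perm_mat N \<sigma> \<in> carrier_mat N N"
    by (simp add: perm_mat_def)
  have "\<epsilon> * vec_norm2 v \<le> \<bar>vec_norm2 ?x - vec_norm2 v\<bar>"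
    using f
  proof
    assume small: "\<forall>i<N. cmod (f i) \<le> 1 - \<epsilon>"
    (* An index exists, so the bound itself is nonnegative. *)
    have "cmod (f 0) \<le> 1 - \<epsilon>"
      using small \<open>N \<ge> 1\<close> by simp
    then have "0 \<le> 1 - \<epsilon>"
      using norm_ge_zero[of "f 0"] by linarith
    then have "vec_norm2 ?x \<le> (1 - \<epsilon>) * vec_norm2 v"
      using small by (intro vec_norm2_mat_diag_le[OF v]) auto
    then show ?thesis
      by (simp add: algebra_simps)
  next
    assume "\<forall>i<N. 1 + \<epsilon> \<le> cmod (f i)"
    then have "(1 + \<epsilon>) * vec_norm2 v \<le> vec_norm2 ?x"
      using \<open>\<epsilon> \<ge> 0\<close> by (intro vec_norm2_mat_diag_ge[OF v]) auto
    then show ?thesis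
      by (simp add: algebra_simps)
  qed
  also have "\<dots> = \<bar>vec_norm2 ?x - vec_norm2 ?y\<bar>"
    by (simp add: vec_norm2_perm_mat[OF \<sigma> v])
  also have "\<dots> \<le> vec_norm2 (?x + ?y)"
    by (rule vec_norm2_diff_le_add[of _ N])
       (simp_all add: mult_mat_vec_carrier[OF mat_diag_dim v] mult_mat_vec_carrier[OF P v])
  also have "?x + ?y = (mat_diag N f + perm_mat N \<sigma>) *\<^sub>v v"
    by (simp add: add_mult_distrib_mat_vec[OF mat_diag_dim P v])
  finally show ?thesis .
qed

theorem corollary1p3:
  fixes \<epsilon> :: real and N :: nat and \<sigma> :: "nat \<Rightarrow> nat" and d :: "nat \<Rightarrow> complex"
    and A :: "complex mat"
  assumes "\<epsilon> > 0" and "N \<ge> 1" and "\<sigma> permutes {1..N}"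
    and "A = mat_diag N (\<lambda>i. d (Suc i)) + perm_mat N \<sigma>"
    and "(\<forall>i\<in>{1..N}. cmod (d i) < 1 - \<epsilon>) \<or> (\<forall>i\<in>{1..N}. cmod (d i) > 1 + \<epsilon>)"
  shows "s_min A \<ge> 1 / (2 * sqrt 2) * \<epsilon>"
proof -
  have A: "A \<in> carrier_mat N N"
    using assms(4) by (simp add: perm_mat_def)
  have d: "(\<forall>i<N. cmod (d (Suc i)) \<le> 1 - \<epsilon>) \<or> (\<forall>i<N. 1 + \<epsilon> \<le> cmod (d (Suc i)))"
    using assms(5)
  proof (elim disjE)
    assume "\<forall>i\<in>{1..N}. cmod (d i) < 1 - \<epsilon>"
    then show ?thesis by (intro disjI1) (simp add: less_imp_le)
  next
    assume "\<forall>i\<in>{1..N}. cmod (d i) > 1 + \<epsilon>"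
    then show ?thesis by (intro disjI2) (simp add: less_imp_le)
  qed
  have "\<epsilon> \<le> s_min A"
  proof (rule s_min_ge[OF A])
    show "\<epsilon> * vec_norm2 v \<le> vec_norm2 (A *\<^sub>v v)" if "v \<in> carrier_vec N" for v
      unfolding assms(4)
      by (rule diag_plus_perm_expanding[OF assms(3) that assms(2) _ d]) (use assms(1) in simp)
  qed (use assms(2) in simp)
  moreover have "1 / (2 * sqrt 2) * \<epsilon> \<le> 1 * \<epsilon>"
  proof (rule mult_right_mono)
    have "1 \<le> sqrt 2" by simp
    then have "1 \<le> 2 * sqrt 2" by linarith
    then show "1 / (2 * sqrt 2) \<le> 1" by simp
  qed (use assms(1) in simp)
  ultimately show ?thesis by simp
qed

end
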